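(* Let $k$ and $m$ be odd positive integers with $\gcd(k,m)=1$, let $e=2^{m-1}-2^{k-1}-1$, $L(x)=\sum_{i=0}^{k-1}x^{2^i}$, and let $(\mathbb{F}_{2^m},+,\diamond)$ be the Dempwolff–Müller pre-quasifield, with multiplication $x\diamond y=x^eL(xy)$. Let $d$ be a positive integer with $d(2^k-1)\equiv 1 \pmod{2^{2m}-1}$. Then for all $x,y\in\mathbb{F}_{2^m}$, $$\diamond\frac{y}{x}=\frac{1}{x\,D_d\left(\frac{y^2}{x^{2^k+1}}\right)},$$ where $D_d$ is the Dickson polynomial.
   Context: Division: for $x\in\mathbb{F}_{2^m}^*$ and $y\in\mathbb{F}_{2^m}$, $\diamond\frac{y}{x}$ denotes the unique $a\in\mathbb{F}_{2^m}$ with $y=a\diamond x$ (such an $a$ exists and is unique since $(\mathbb{F}_{2^m},+,\diamond)$, with the field addition, is known to be a left pre-quasifield: right multiplication by a nonzero element is a bijection); moreover $\diamond\frac{y}{0}=0$ for all $y$. Dickson polynomial: for a positive integer $d$, $D_d(x)=\sum_{i=0}^{\lfloor d/2\rfloor}\frac{d}{d-i}\binom{d-i}{i}x^{d-2i}$, where the coefficients are integers, reduced modulo $2$. Conventions: $\frac{1}{0}$ is interpreted as $0$ (that is, $\frac1x$ is identified with $x^{2^m-2}$ in the sense that it is the inverse of $x$ for $x\neq 0$ and is $0$ for $x=0$), and a quotient with zero denominator is $0$. For $x\neq0$ the power $x^e$ is taken in the multiplicative group $\mathbb{F}_{2^m}^*$ (so $e$ may be negative), and $x\diamond y=0$ if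 $x=0$. *)

theory Defs
  imports
    Complex_Main
    "HOL-Computational_Algebra.Polynomial"
    "HOL-Number_Theory.Cong"
    "HOL-Library.Cardinality"
begin

definition dm_exponent :: "nat \<Rightarrow> nat \<Rightarrow> int" where
  "dm_exponent k m = 2 ^ (m - 1) - 2 ^ (k - 1) - 1"

definition dm_L :: "nat \<Rightarrow> 'a::field \<Rightarrow> 'a" where
  "dm_L k x = (\<Sum>i = 0..k - 1. x ^ (2 ^ i))"

text \<open>The exponent may be negative, hence the integer power \<open>powi\<close>.\<close>

definition dm_mult :: "nat \<Rightarrow> nat \<Rightarrow> 'a::field \<Rightarrow> 'a \<Rightarrow> 'a" where
  "dm_mult k m x y = (if x = 0 then 0 else x powi dm_exponent k m * dm_L k (x * y))"

text \<open>\<open>dm_div k m y x\<close> is the quotient of \<open>y\<close> by \<open>x\<close>: the left factor \<open>a\<close> in \<open>y = a \<diamondop> x\<close>,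
  where \<open>\<diamondop>\<close> is \<open>dm_mult k m\<close>.\<close>

definition dm_div :: "nat \<Rightarrow> nat \<Rightarrow> 'a::field \<Rightarrow> 'a \<Rightarrow> 'a" where
  "dm_div k m y x = (if x = 0 then 0 else (THE a. y = dm_mult k m a x))"

text \<open>The integer \<open>d / (d - i) * (d - i choose i)\<close>. The natural-number division is exact,
  see \<open>dickson_coeff_exact\<close>.\<close>

definition dickson_coeff :: "nat \<Rightarrow> nat \<Rightarrow> nat" where
  "dickson_coeff d i = d * ((d - i) choose i) div (d - i)"

lemma dickson_coeff_exact:
  assumes "0 < d" "i \<le> d div 2"
  shows "real (dickson_coeff d i) = real d / real (d - i) * real ((d - i) choose i)"
proof -
  have pos: "0 < d - i"
    using assms by linarith
  have "(d - i) dvd d * ((d - i) choose i)"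
  proof (cases i)
    case 0
    then show ?thesis by simp
  next
    case (Suc j)
    obtain n where n: "d - i = Suc n"
      using pos gr0_implies_Suc by blast
    have "d = (d - i) + i"
      using assms by linarith
    then have "d * ((d - i) choose i) = (d - i) * ((d - i) choose i) + i * ((d - i) choose i)"
      by (metis add_mult_distrib)
    also have "i * ((d - i) choose i) = (d - i) * (n choose j)"
      using Suc_times_binomial[of j n] by (simp only: n Suc[symmetric])
    finally show ?thesis
      by simp
  qed
  then show ?thesis
    unfolding dickson_coeff_def by (simp add: real_of_nat_div)
qed

text \<open>The Dickson polynomial with all signs positive, as is appropriate in characteristic 2;
  there \<open>of_nat\<close> reduces the integer coefficients modulo 2.\<close>

definition dickson_poly :: "nat \<Rightarrow> 'a::comm_ring_1 poly" where
  "dickson_poly d = (\<Sum>i = 0..d div 2. monom (of_nat (dickson_coeff d i)) (d - 2 * i))"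

end

theory Submission
  imports Defs "HOL-Number_Theory.Residues"
begin

text \<open>In characteristic 2 the Dickson polynomials satisfy \<open>D\<^bsub>n+2\<^esub> = x D\<^bsub>n+1\<^esub> + D\<^bsub>n\<^esub>\<close> with
  \<open>D\<^bsub>0\<^esub> = 2 = 0\<close>. Working with the resulting sequence of values, rather than with
  \<open>D\<^bsub>n\<^esub>(w + 1/w) = w\<^sup>n + w\<^bsup>-n\<^esup>\<close>, avoids the quadratic extension field. Write \<open>q = 2\<^sup>m\<close> for the
  order of the field. As \<open>D\<close> has the closed form
  \<open>D\<^bsub>2^j-1\<^esub>(1/u) = (\<Sum>i<j. u\<^bsup>2^i\<^esup>)\<^sup>2 / u\<^bsup>2^j+1\<^esup>\<close>, the case \<open>j = 2m\<close>, where the sum runs twice through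
  the trace of \<open>u\<close>, shows that the sequence has period \<open>q\<^sup>2 - 1\<close>, while the case \<open>j = k\<close> says that
  \<open>y = a \<diamondop> x\<close> with \<open>a x = u \<noteq> 0\<close> amounts to
  \<open>y\<^sup>2 / x\<^bsup>2^k+1\<^esup> = D\<^bsub>2^k-1\<^esub>(1/u)\<close>. Applying \<open>D\<^bsub>d\<^esub>\<close> and using
  \<open>D\<^bsub>d\<^esub> \<circ> D\<^bsub>2^k-1\<^esub> = D\<^bsub>d(2^k-1)\<^esub>\<close> recovers \<open>1/u\<close>. In particular
  \<open>a\<close> is determined by \<open>x\<close> and \<open>y\<close>, and it exists because the field is finite.\<close>

section \<open>Finite fields of characteristic 2\<close>

lemma finite_field_power_CARD:
  fixes x :: "'a::{finite, field}"
  shows "x ^ CARD('a) = x"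
proof (cases "x = 0")
  case False
  have "bij_betw ((*) x) (UNIV - {0}) (UNIV - {0})"
    by (rule bij_betwI[where g = "\<lambda>y. y / x"]) (use False in auto)
  then have "\<Prod>(UNIV - {0}) = (\<Prod>y\<in>UNIV - {0}. x * y)"
    by (rule prod.reindex_bij_betw[symmetric])
  also have "\<dots> = x ^ (CARD('a) - 1) * \<Prod>(UNIV - {0})"
    by (simp add: prod.distrib card_Diff_singleton)
  finally have "x ^ (CARD('a) - 1) = 1"
    by simp
  then show ?thesis
    using power_minus_mult[of "CARD('a)" x] by simp
qed simp

lemma CHAR_eq_2:
  assumes "CARD('a::{finite, field}) = 2 ^ m"
  shows "CHAR('a) = 2"
proof -
  have "prime CHAR('a)"
    by (rule prime_CHAR_semidom) (simp add: finite_imp_CHAR_pos)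
  moreover have "CHAR('a) dvd 2 ^ m"
    using CHAR_dvd_CARD[where 'a = 'a] assms by simp
  ultimately show ?thesis
    by (metis prime_dvd_power primes_dvd_imp_eq two_is_prime_nat)
qed

lemma add_self_CHAR_2:
  assumes "CHAR('a::ring_1) = 2"
  shows "x + x = (0 :: 'a)"
  using minus_CHAR_2[OF assms, of x x] by simp

lemma add_add_CHAR_2:
  assumes "CHAR('a::ring_1) = 2"
  shows "x + (x + y) = (y :: 'a)"
  by (simp add: assms add_self_CHAR_2 flip: add.assoc)

lemma add_power2_CHAR_2:
  assumes "CHAR('a::comm_ring_1) = 2"
  shows "(x + y) ^ 2 = x ^ 2 + (y :: 'a) ^ 2"
proof -
  have "(2 :: 'a) = 0"
    using add_self_CHAR_2[OF assms, of 1] by simp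
  then show ?thesis
    by (simp add: power2_sum)
qed

section \<open>Dickson polynomials\<close>

lemma dickson_coeff_0: "0 < d \<Longrightarrow> dickson_coeff d 0 = 1"
  by (simp add: dickson_coeff_def)

text \<open>From i * C(d-i, i) = (d-i) * C(d-i-1, i-1). A sum of two binomials is what Pascal's rule
  can be applied to.\<close>

lemma dickson_coeff_Suc:
  "dickson_coeff (Suc p + Suc j) (Suc j) = (Suc p choose Suc j) + (p choose j)"
proof -
  have "(Suc p + Suc j) * (Suc p choose Suc j) = Suc p * ((Suc p choose Suc j) + (p choose j))"
    using Suc_times_binomial[of j p] by (simp only: add_mult_distrib distrib_left)
  moreover have "Suc p + Suc j - Suc j = Suc p"
    by simp
  ultimately show ?thesis
    unfolding dickson_coeff_def by (metis nonzero_mult_div_cancel_left nat.distinct(1))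
qed

lemma dickson_coeff_rec:
  assumes "0 < d" "i \<le> d div 2"
  shows "dickson_coeff (d + 2) (Suc i) = dickson_coeff (d + 1) (Suc i) + dickson_coeff d i"
proof -
  obtain p where p: "d = Suc p + i"
  proof
    show "d = Suc (d - i - 1) + i"
      using assms by linarith
  qed
  have 1: "dickson_coeff (d + 2) (Suc i) = (Suc (Suc p) choose Suc i) + (Suc p choose i)"
    using dickson_coeff_Suc[of "Suc p" i] by (simp add: p)
  have 2: "dickson_coeff (d + 1) (Suc i) = (Suc p choose Suc i) + (p choose i)"
    using dickson_coeff_Suc[of p i] by (simp add: p)
  show ?thesis
  proof (cases i)
    case 0
    then show ?thesis
      using 1 2 assms by (simp add: dickson_coeff_0)
  next
    case (Suc j)
    have "dickson_coeff d i = (Suc p choose Suc j) + (p choose j)"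
      using dickson_coeff_Suc[of p j] by (simp add: p Suc)
    then show ?thesis
      using 1 2 by (simp add: Suc)
  qed
qed

lemma poly_dickson_poly:
  "poly (dickson_poly d) v = (\<Sum>i\<le>d div 2. of_nat (dickson_coeff d i) * v ^ (d - 2 * i))"
  by (simp add: dickson_poly_def poly_sum poly_monom atMost_atLeast0)

lemma poly_dickson_poly_rec:
  fixes v :: "'a::comm_ring_1"
  assumes "0 < d"
  shows "poly (dickson_poly (d + 2)) v = v * poly (dickson_poly (d + 1)) v + poly (dickson_poly d) v"
proof -
  define c where "c n i = (of_nat (dickson_coeff n i) :: 'a)" for n i
  have D: "poly (dickson_poly n) v = (\<Sum>i\<le>n div 2. c n i * v ^ (n - 2 * i))" for n
    by (simp add: poly_dickson_poly c_def)
  have "v * poly (dickson_poly (d + 1)) v = (\<Sum>i\<le>(d + 1) div 2. c (d + 1) i * v ^ (d + 2 - 2 * i))"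
    unfolding D sum_distrib_left
  proof (rule sum.cong)
    fix i assume "i \<in> {..(d + 1) div 2}"
    then have "d + 2 - 2 * i = Suc (d + 1 - 2 * i)"
      by auto
    then show "v * (c (d + 1) i * v ^ (d + 1 - 2 * i)) = c (d + 1) i * v ^ (d + 2 - 2 * i)"
      by simp
  qed simp
  \<comment> \<open>For even \<open>d\<close> this adds one index, \<open>i = d div 2 + 1\<close>;
    its coefficient vanishes because \<open>d + 1 - i < i\<close>.\<close>
  also have "\<dots> = (\<Sum>i\<le>Suc (d div 2). c (d + 1) i * v ^ (d + 2 - 2 * i))"
  proof (rule sum.mono_neutral_left)
    show "\<forall>i\<in>{..Suc (d div 2)} - {..(d + 1) div 2}. c (d + 1) i * v ^ (d + 2 - 2 * i) = 0"
    proof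
      fix i assume i: "i \<in> {..Suc (d div 2)} - {..(d + 1) div 2}"
      then have "d + 1 - i < i"
        by auto
      then show "c (d + 1) i * v ^ (d + 2 - 2 * i) = 0"
        by (simp add: c_def dickson_coeff_def binomial_eq_0)
    qed
  qed auto
  also have "\<dots> = v ^ (d + 2) + (\<Sum>i\<le>d div 2. c (d + 1) (Suc i) * v ^ (d - 2 * i))"
    by (simp add: sum.atMost_Suc_shift c_def dickson_coeff_0 del: sum.atMost_Suc)
  finally have 1: "v * poly (dickson_poly (d + 1)) v =
      v ^ (d + 2) + (\<Sum>i\<le>d div 2. c (d + 1) (Suc i) * v ^ (d - 2 * i))" .
  have "(d + 2) div 2 = Suc (d div 2)"
    by simp
  then have "poly (dickson_poly (d + 2)) v =
      v ^ (d + 2) + (\<Sum>i\<le>d div 2. c (d + 2) (Suc i) * v ^ (d - 2 * i))"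
    unfolding D by (simp add: sum.atMost_Suc_shift c_def dickson_coeff_0
        del: sum.atMost_Suc div_add_self2)
  also have "(\<Sum>i\<le>d div 2. c (d + 2) (Suc i) * v ^ (d - 2 * i)) =
      (\<Sum>i\<le>d div 2. c (d + 1) (Suc i) * v ^ (d - 2 * i)) + (\<Sum>i\<le>d div 2. c d i * v ^ (d - 2 * i))"
    unfolding sum.distrib[symmetric]
  proof (rule sum.cong)
    fix i assume "i \<in> {..d div 2}"
    then have "c (d + 2) (Suc i) = c (d + 1) (Suc i) + c d i"
      using dickson_coeff_rec[OF assms, of i] by (simp add: c_def)
    then show "c (d + 2) (Suc i) * v ^ (d - 2 * i) =
        c (d + 1) (Suc i) * v ^ (d - 2 * i) + c d i * v ^ (d - 2 * i)"
      by (simp add: distrib_right)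
  qed simp
  finally show ?thesis
    unfolding 1 D[of d] by (simp add: add.assoc)
qed

section \<open>Dickson sequences in characteristic 2\<close>

fun dickson_seq :: "'a::comm_ring_1 \<Rightarrow> nat \<Rightarrow> 'a" where
  "dickson_seq v 0 = 0"
| "dickson_seq v (Suc 0) = v"
| "dickson_seq v (Suc (Suc n)) = v * dickson_seq v (Suc n) + dickson_seq v n"

lemma poly_dickson_poly_eq_seq:
  fixes v :: "'a::comm_ring_1"
  assumes "CHAR('a) = 2" "0 < d"
  shows "poly (dickson_poly d) v = dickson_seq v d"
proof -
  have "(2 :: 'a) = 0"
    using add_self_CHAR_2[OF assms(1), of 1] by simp
  \<comment> \<open>A second base case: the polynomial recursion starts at a positive index.\<close>
  then have 2: "poly (dickson_poly 2) v = v ^ 2"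
    by (simp add: poly_dickson_poly dickson_coeff_def)
  have "poly (dickson_poly (Suc n)) v = dickson_seq v (Suc n)" for n
  proof (induction n rule: induct_nat_012)
    case 0
    show ?case
      by (simp add: poly_dickson_poly dickson_coeff_def)
  next
    case 1
    show ?case
      using 2 by (simp add: power2_eq_square numeral_2_eq_2)
  next
    case (ge2 n)
    then show ?case
      using poly_dickson_poly_rec[of "Suc n" v] by simp
  qed
  then show ?thesis
    using assms(2) gr0_implies_Suc by blast
qed

lemma dickson_seq_at_0: "dickson_seq 0 n = 0"
  by (induction n rule: induct_nat_012) auto

text \<open>For v = w + 1/w this is the product of w^(b+c) + w^-(b+c) and w^b + w^-b, multiplied
  out. Having \<open>c\<close> as the difference of the indices avoids subtraction.\<close>

lemma dickson_seq_mult: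
  fixes v :: "'a::comm_ring_1"
  assumes "CHAR('a) = 2"
  shows "dickson_seq v (b + c) * dickson_seq v b = dickson_seq v (b + b + c) + dickson_seq v c"
proof (induction b arbitrary: c rule: induct_nat_012)
  case 0
  show ?case
    by (simp add: add_self_CHAR_2[OF assms])
next
  case 1
  show ?case
    by (simp add: add.assoc add_self_CHAR_2[OF assms] mult.commute)
next
  case (ge2 b)
  let ?D = "dickson_seq v"
  \<comment> \<open>Only the second factor is unfolded; what is taken from \<open>b\<close> moves
    into \<open>c\<close>, so the hypotheses apply at \<open>Suc c\<close> and
    \<open>Suc (Suc c)\<close>.\<close>
  have "?D (Suc (Suc b) + c) * ?D (Suc (Suc b)) =
      v * (?D (Suc b + Suc c) * ?D (Suc b)) + ?D (b + Suc (Suc c)) * ?D b"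
    by (simp add: algebra_simps)
  also have "\<dots> = v * (?D (Suc b + Suc b + Suc c) + ?D (Suc c)) +
      (?D (b + b + Suc (Suc c)) + ?D (Suc (Suc c)))"
    by (simp only: ge2)
  also have "\<dots> = (v * ?D (Suc b + Suc b + Suc c) + ?D (b + b + Suc (Suc c))) +
      (v * ?D (Suc c) + (v * ?D (Suc c) + ?D c))"
    by (simp add: algebra_simps)
  also have "\<dots> = ?D (Suc (Suc b) + Suc (Suc b) + c) + ?D c"
    by (simp add: add_add_CHAR_2[OF assms])
  finally show ?case .
qed

text \<open>The product identity with \<open>c = n * b\<close> is the recursion with parameter
  \<open>dickson_seq v b\<close> for every \<open>b\<close>-th value.\<close>

lemma dickson_seq_compose:
  fixes v :: "'a::comm_ring_1"
  assumes "CHAR('a) = 2"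
  shows "dickson_seq (dickson_seq v b) n = dickson_seq v (n * b)"
proof (induction n rule: induct_nat_012)
  case (ge2 n)
  have "dickson_seq v (b + b + n * b) =
      dickson_seq v (b + n * b) * dickson_seq v b + dickson_seq v (n * b)"
    by (simp add: dickson_seq_mult[OF assms] add.assoc add_self_CHAR_2[OF assms])
  then show ?case
    using ge2 by (simp add: add.assoc mult.commute)
qed auto

lemma dickson_seq_power2:
  fixes v :: "'a::comm_ring_1"
  assumes "CHAR('a) = 2"
  shows "dickson_seq v (2 ^ j) = v ^ (2 ^ j)"
proof (induction j)
  case (Suc j)
  have "dickson_seq v (2 ^ Suc j) = dickson_seq v (2 ^ j) ^ 2"
    using dickson_seq_mult[OF assms, of v "2 ^ j" 0] by (simp add: power2_eq_square mult_2)
  then show ?case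
    by (simp add: Suc power_mult[symmetric] mult.commute)
qed simp

lemma dickson_seq_power2_minus_1:
  fixes u :: "'a::field"
  assumes "CHAR('a) = 2" "u \<noteq> 0"
  shows "dickson_seq (1 / u) (2 ^ j - 1) = (\<Sum>i<j. u ^ (2 ^ i)) ^ 2 / u ^ (2 ^ j + 1)"
proof (induction j)
  case (Suc j)
  let ?D = "dickson_seq (1 / u)" and ?S = "\<Sum>i<j. u ^ (2 ^ i)"
  \<comment> \<open>Prepares the product identity at \<open>b = 2 ^ j - 1\<close> and
    \<open>c = 1\<close>, which leads from \<open>j\<close> to \<open>Suc j\<close>.\<close>
  have "(0::nat) < 2 ^ j"
    by simp
  then have "(2::nat) ^ j - 1 + 1 = 2 ^ j" "(2::nat) ^ j - 1 + (2 ^ j - 1) + 1 = 2 ^ Suc j - 1"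
    unfolding power_Suc by linarith+
  then have "?D (2 ^ j) * ?D (2 ^ j - 1) = ?D (2 ^ Suc j - 1) + 1 / u"
    using dickson_seq_mult[OF assms(1), of "1 / u" "2 ^ j - 1" 1]
    by (metis One_nat_def dickson_seq.simps(2))
  then have "?D (2 ^ Suc j - 1) = ?D (2 ^ j) * ?D (2 ^ j - 1) + 1 / u"
    by (simp add: add.assoc add_self_CHAR_2[OF assms(1)])
  also have "\<dots> = (1 / u) ^ (2 ^ j) * (?S ^ 2 / u ^ (2 ^ j + 1)) + 1 / u"
    by (simp only: Suc dickson_seq_power2[OF assms(1)])
  also have "\<dots> = (?S ^ 2 + u ^ (2 ^ Suc j)) / u ^ (2 ^ Suc j + 1)"
  proof -
    have "u ^ (2 ^ Suc j) = u ^ (2 ^ j) * u ^ (2 ^ j)"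
      by (simp only: power_Suc mult_2 power_add)
    then show ?thesis
      using assms(2) by (simp add: divide_simps)
  qed
  also have "?S ^ 2 + u ^ (2 ^ Suc j) = (\<Sum>i<Suc j. u ^ (2 ^ i)) ^ 2"
    by (simp add: add_power2_CHAR_2[OF assms(1)] power_mult[symmetric] mult.commute)
  finally show ?case .
qed simp

lemma dickson_seq_mod_period:
  fixes v :: "'a::{finite, field}"
  assumes "CARD('a) = 2 ^ m"
  shows "dickson_seq v (n mod (2 ^ (2 * m) - 1)) = dickson_seq v n"
proof (cases "v = 0")
  case False
  note char = CHAR_eq_2[OF assms]
  have fix_q: "z ^ (2 ^ m) = z" for z :: 'a
    using finite_field_power_CARD[of z] assms by simp
  define P :: nat where "P = 2 ^ (2 * m) - 1"
  let ?u = "1 / v"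
  have split: "(\<Sum>i<m + n. ?u ^ (2 ^ i)) = (\<Sum>i<m. ?u ^ (2 ^ i)) + (\<Sum>i<n. ?u ^ (2 ^ (m + i)))" for n
    by (induction n) (simp_all add: add.assoc)
  note split[of m]
  also have "(\<Sum>i<m. ?u ^ (2 ^ (m + i))) = (\<Sum>i<m. ?u ^ (2 ^ i))"
    by (simp only: power_add power_mult fix_q)
  finally have "(\<Sum>i<2 * m. ?u ^ (2 ^ i)) = 0"
    by (simp add: add_self_CHAR_2[OF char] mult_2)
  then have P0: "dickson_seq v P = 0"
    using dickson_seq_power2_minus_1[OF char, of ?u "2 * m"] False by (simp add: P_def)
  have "Suc P = 2 ^ (2 * m)"
    by (simp add: P_def)
  then have "dickson_seq v (Suc P) = v ^ (2 ^ (m + m))"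
    by (simp only: dickson_seq_power2[OF char] mult_2)
  also have "\<dots> = v"
    by (simp only: power_add power_mult fix_q)
  finally have P1: "dickson_seq v (Suc P) = v" .
  \<comment> \<open>Two consecutive values recur, and the recursion has order two.\<close>
  have period: "dickson_seq v (i + P) = dickson_seq v i" for i
    by (induction i rule: induct_nat_012) (simp_all add: P0 P1)
  have "dickson_seq v (i + j * P) = dickson_seq v i" for i j
  proof (induction j)
    case (Suc j)
    have "i + Suc j * P = i + j * P + P"
      by simp
    then show ?case
      by (simp only: period Suc)
  qed simp
  from this[of "n mod P" "n div P"] show ?thesis
    unfolding P_def[symmetric] by simp
qed (simp add: dickson_seq_at_0)

section \<open>The quotient\<close>

text \<open>Twice the exponent is 2^m - (2^k + 2), so a^(2^m) = a turns the squared power of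
  \<open>a\<close> into 1/a^(2^k+1). With u = a x the left side is L(u)^2 / u^(2^k+1).\<close>

lemma dm_mult_power2:
  fixes a x :: "'a::{finite, field}"
  assumes "0 < k" "0 < m" "CARD('a) = 2 ^ m" "a \<noteq> 0" "x \<noteq> 0"
  shows "dm_mult k m a x ^ 2 / x ^ (2 ^ k + 1) = dickson_seq (1 / (a * x)) (2 ^ k - 1)"
proof -
  have "a ^ (2 ^ m) = a"
    using finite_field_power_CARD[of a] assms by simp
  then have "a powi (2 ^ m) = a"
    by (metis power_int_of_nat of_nat_numeral of_nat_power)
  moreover have "2 * dm_exponent k m = 2 ^ m - (2 ^ k + 2)"
    using assms by (cases k; cases m) (simp_all add: dm_exponent_def)
  moreover have "a powi (2 ^ k + 2) = a * a ^ (2 ^ k + 1)"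
    using power_int_of_nat[of a "2 ^ k + 2"] by (simp add: add.commute)
  ultimately have "a powi (2 * dm_exponent k m) = a / (a * a ^ (2 ^ k + 1))"
    using power_int_diff[of a "2 ^ m" "2 ^ k + 2"] assms(4) by simp
  also have "\<dots> = 1 / a ^ (2 ^ k + 1)"
    using assms(4) by simp
  finally have "(a powi dm_exponent k m) ^ 2 = 1 / a ^ (2 ^ k + 1)"
    by (simp add: power_int_mult mult.commute[of 2] power_int_numeral)
  moreover have "dm_L k (a * x) = (\<Sum>i<k. (a * x) ^ (2 ^ i))"
    using assms(1) unfolding dm_L_def by (intro sum.cong) auto
  ultimately show ?thesis
    using assms dickson_seq_power2_minus_1[OF CHAR_eq_2, of m "a * x" k]
    by (simp add: dm_mult_def power_mult_distrib)
qed

theorem theorem4p2: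
  fixes x y :: "'a::{finite, field}" and k m d :: nat
  assumes "odd k" and "odd m" and "coprime k m"
    and "CARD('a) = 2 ^ m"
    and "0 < d" and "[d * (2 ^ k - 1) = 1] (mod (2 ^ (2 * m) - 1))"
  shows "dm_div k m y x = 1 / (x * poly (dickson_poly d) (y ^ 2 / x ^ (2 ^ k + 1)))"
proof (cases "x = 0")
  case False
  note char = CHAR_eq_2[OF assms(4)]
  have pos: "0 < k" "0 < m"
    using assms(1,2) odd_pos by auto
  define f where "f z = 1 / (x * poly (dickson_poly d) (z ^ 2 / x ^ (2 ^ k + 1)))" for z
  have inverse: "f (dm_mult k m a x) = a" for a
  proof (cases "a = 0")
    case True
    \<comment> \<open>Here the Dickson value is 0, and \<open>1 / 0 = 0\<close> returns
      \<open>a\<close>.\<close>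
    then show ?thesis
      by (simp add: f_def dm_mult_def poly_dickson_poly_eq_seq[OF char assms(5)] dickson_seq_at_0)
  next
    case a: False
    let ?v = "1 / (a * x)"
    have "poly (dickson_poly d) (dm_mult k m a x ^ 2 / x ^ (2 ^ k + 1)) =
        dickson_seq ?v (d * (2 ^ k - 1))"
      using dm_mult_power2[OF pos assms(4) a False]
      by (simp add: poly_dickson_poly_eq_seq[OF char assms(5)] dickson_seq_compose[OF char])
    \<comment> \<open>The index is congruent to 1 modulo the period.\<close>
    also have "\<dots> = dickson_seq ?v 1"
      using assms(6) dickson_seq_mod_period[OF assms(4), of ?v]
      unfolding cong_def by metis
    finally show ?thesis
      using a False by (simp add: f_def)
  qed
  then have "inj (\<lambda>a. dm_mult k m a x)"
    by (rule inj_on_inverseI)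
  then have "surj (\<lambda>a. dm_mult k m a x)"
    by (simp add: finite_UNIV_inj_surj)
  then obtain a where a: "y = dm_mult k m a x"
    by (meson surjD)
  \<comment> \<open>The left inverse \<open>f\<close> forces every solution to be
    \<open>f y\<close>.\<close>
  then have "(THE a. y = dm_mult k m a x) = f y"
    by (intro the_equality) (metis inverse)+
  then show ?thesis
    using False by (simp add: dm_div_def f_def)
qed (simp add: dm_div_def)

end
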